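(* Let $H$ be an abelian group (a $\mathbb{Z}$-module, not necessarily finitely generated) with an alternating $\mathbb{Z}$-bilinear form $\langle -,-\rangle : H\times H\to\mathbb{Z}$, and suppose $\langle -,-\rangle \neq 0$. Then there are $\mathbb{Q}$-linear isomorphisms \[ H_2(\mathbb{Q}[H]^{(1)})\cong \bigoplus_{z\in\ker\mu}\mathbb{Q}\otimes_{\mathbb{Z}}(H/\mathbb{Z}z) \quad\text{and}\quad H_2(\mathbb{Q}[H])\cong \Big(\textstyle\bigwedge^2_{\mathbb{Q}}\mathbb{Q}[\ker\mu]\Big)\oplus H_2(\mathbb{Q}[H]^{(1)}). \]
   Context: Define $\mu:H\to\mathrm{Hom}_{\mathbb{Z}}(H,\mathbb{Z})$ by $\mu(x)(y)=\langle x,y\rangle$. For a subset $S\subset H$, $\mathbb{Q}[S]$ denotes the $\mathbb{Q}$-vector space with basis the formal symbols $[x]$, $x\in S$ (so $c[x]\neq[cx]$ in general). The homological Goldman Lie algebra is $\mathbb{Q}[H]$ with the bracket $[[x],[y]]=\langle x,y\rangle[x+y]$ extended bilinearly; it is a Lie algebra. Its derived subalgebra $\mathbb{Q}[H]^{(1)}=[\mathbb{Q}[H],\mathbb{Q}[H]]$ equals $\mathbb{Q}[H\setminus\ker\mu]$, and its center is $\mathbb{Q}[\ker\mu]$, so $\mathbb{Q}[H]=\mathbb{Q}[\ker\mu]\oplus\mathbb{Q}[H\setminus\ker\mu]$. $\bigwedge^2_{\mathbb{Q}}\mathbb{Q}[\ker\mu]$ is the exterior square of the vector space $\mathbb{Q}[\ker\mu]$.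 For a Lie algebra $\mathfrak g$ over $\mathbb{Q}$, $H_*(\mathfrak g)$ is Lie algebra homology with trivial coefficients $\mathbb{Q}$, computed by the Chevalley–Eilenberg complex $C_p(\mathfrak g)=\bigwedge^p_{\mathbb{Q}}\mathfrak g$ with $\partial(x_1\wedge\cdots\wedge x_p)=\sum_{i<j}(-1)^{i+j}[x_i,x_j]\wedge x_1\wedge\cdots\widehat{x_i}\cdots\widehat{x_j}\cdots\wedge x_p$. *)

theory Defs
  imports Complex_Main "HOL-Library.Function_Algebras"
begin

definition smultf :: "rat \<Rightarrow> ('a \<Rightarrow> rat) \<Rightarrow> ('a \<Rightarrow> rat)" (infixr "*s" 75) where
  "c *s f = (\<lambda>x. c * f x)"

definition delta :: "'a \<Rightarrow> ('a \<Rightarrow> rat)" where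
  "delta a = (\<lambda>x. if x = a then 1 else 0)"

definition fsupp :: "('a \<Rightarrow> rat) \<Rightarrow> 'a set" where
  "fsupp f = {x. f x \<noteq> 0}"

text \<open>Q[S]: the Q-vector space with basis the symbols [x], x in S; [x] is delta x.\<close>
definition finsupp_on :: "'a set \<Rightarrow> ('a \<Rightarrow> rat) set" where
  "finsupp_on S = {f. finite (fsupp f) \<and> fsupp f \<subseteq> S}"

definition qspan :: "('a \<Rightarrow> rat) set \<Rightarrow> ('a \<Rightarrow> rat) set" where
  "qspan G = {v. \<exists>t r. finite t \<and> t \<subseteq> G \<and> v = (\<Sum>b\<in>t. r b *s b)}"

definition dsum :: "('a \<Rightarrow> rat) set \<Rightarrow> ('b \<Rightarrow> rat) set \<Rightarrow> (('a + 'b) \<Rightarrow> rat) set" where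
  "dsum V W = {F. (\<lambda>a. F (Inl a)) \<in> V \<and> (\<lambda>b. F (Inr b)) \<in> W}"

definition linear_on :: "('a \<Rightarrow> rat) set \<Rightarrow> (('a \<Rightarrow> rat) \<Rightarrow> ('b \<Rightarrow> rat)) \<Rightarrow> bool" where
  "linear_on V f \<longleftrightarrow> (\<forall>u\<in>V. \<forall>v\<in>V. \<forall>c. f (c *s u + v) = c *s f u + f v)"

text \<open>For subspaces W1 of V1 and W2 of V2: there is a Q-linear isomorphism V1/W1 = V2/W2
  (induced by a linear map f : V1 -> V2 with f^{-1}(W2) = W1 and V2 = f(V1) + W2).\<close>
definition quot_iso :: "('a \<Rightarrow> rat) set \<Rightarrow> ('a \<Rightarrow> rat) set \<Rightarrow> ('b \<Rightarrow> rat) set \<Rightarrow> ('b \<Rightarrow> rat) set \<Rightarrow> bool" where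
  "quot_iso V1 W1 V2 W2 \<longleftrightarrow> (\<exists>f. linear_on V1 f \<and> f ` V1 \<subseteq> V2
      \<and> (\<forall>v\<in>V2. \<exists>u\<in>V1. v - f u \<in> W2)
      \<and> (\<forall>u\<in>V1. f u \<in> W2 \<longleftrightarrow> u \<in> W1))"

definition kerf :: "('h \<Rightarrow> 'h \<Rightarrow> int) \<Rightarrow> 'h set" where
  "kerf form = {x. \<forall>y. form x y = 0}"

definition gbracket :: "('h::ab_group_add \<Rightarrow> 'h \<Rightarrow> int) \<Rightarrow> 'h \<Rightarrow> 'h \<Rightarrow> ('h \<Rightarrow> rat)" where
  "gbracket form x y = of_int (form x y) *s delta (x + y)"

text \<open>Exterior powers of Q[S] are modelled as finitely supported alternating functions:
  an alternating function w on S x S stands for (1/2) sum w(x,y) [x]/\[y], where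
  [x]/\[y] is represented by wedge2 x y; similarly in degree 3 with factor 1/6.\<close>

definition wedge2 :: "'h \<Rightarrow> 'h \<Rightarrow> ('h \<times> 'h \<Rightarrow> rat)" where
  "wedge2 x y = delta (x, y) - delta (y, x)"

definition C2 :: "'h set \<Rightarrow> ('h \<times> 'h \<Rightarrow> rat) set" where
  "C2 S = {w \<in> finsupp_on (S \<times> S). \<forall>x y. w (x, y) = - w (y, x)}"

definition C3 :: "'h set \<Rightarrow> ('h \<times> 'h \<times> 'h \<Rightarrow> rat) set" where
  "C3 S = {w \<in> finsupp_on (S \<times> S \<times> S).
      \<forall>x y z. w (x, y, z) = - w (y, x, z) \<and> w (x, y, z) = - w (x, z, y)}"

definition bd2 :: "('h::ab_group_add \<Rightarrow> 'h \<Rightarrow> int) \<Rightarrow> ('h \<times> 'h \<Rightarrow> rat) \<Rightarrow> ('h \<Rightarrow> rat)" where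
  "bd2 form w = (\<Sum>p\<in>fsupp w. (w p / 2) *s (- gbracket form (fst p) (snd p)))"

definition bd3_basis :: "('h::ab_group_add \<Rightarrow> 'h \<Rightarrow> int) \<Rightarrow> 'h \<Rightarrow> 'h \<Rightarrow> 'h \<Rightarrow> ('h \<times> 'h \<Rightarrow> rat)" where
  "bd3_basis form x y z =
      - (of_int (form x y) *s wedge2 (x + y) z)
      + (of_int (form x z) *s wedge2 (x + z) y)
      - (of_int (form y z) *s wedge2 (y + z) x)"

definition bd3 :: "('h::ab_group_add \<Rightarrow> 'h \<Rightarrow> int) \<Rightarrow> ('h \<times> 'h \<times> 'h \<Rightarrow> rat) \<Rightarrow> ('h \<times> 'h \<Rightarrow> rat)" where
  "bd3 form w = (\<Sum>p\<in>fsupp w. (w p / 6) *s bd3_basis form (fst p) (fst (snd p)) (snd (snd p)))"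

definition Z2 :: "('h::ab_group_add \<Rightarrow> 'h \<Rightarrow> int) \<Rightarrow> 'h set \<Rightarrow> ('h \<times> 'h \<Rightarrow> rat) set" where
  "Z2 form S = {w \<in> C2 S. bd2 form w = 0}"

definition B2 :: "('h::ab_group_add \<Rightarrow> 'h \<Rightarrow> int) \<Rightarrow> 'h set \<Rightarrow> ('h \<times> 'h \<Rightarrow> rat) set" where
  "B2 form S = bd3 form ` C3 S"

definition zsub :: "'h::ab_group_add \<Rightarrow> 'h set" where
  "zsub z = {x. \<exists>n::nat. x = (\<Sum>i<n. z) \<or> x = - (\<Sum>i<n. z)}"

definition cosets :: "'h::ab_group_add \<Rightarrow> 'h set set" where
  "cosets z = range (\<lambda>a. (\<lambda>x. a + x) ` zsub z)"

definition setplus :: "'h::ab_group_add set \<Rightarrow> 'h set \<Rightarrow> 'h set" where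
  "setplus A C = {a + c | a c. a \<in> A \<and> c \<in> C}"

text \<open>Q (x)_Z A presented as Q[A] modulo the span of [a+b]-[a]-[b]; direct sum over z
  encoded by indexing with pairs (z, coset).\<close>
definition tens_space :: "('h::ab_group_add \<Rightarrow> 'h \<Rightarrow> int) \<Rightarrow> ('h \<times> 'h set \<Rightarrow> rat) set" where
  "tens_space form = finsupp_on {(z, A). z \<in> kerf form \<and> A \<in> cosets z}"

definition tens_rel :: "('h::ab_group_add \<Rightarrow> 'h \<Rightarrow> int) \<Rightarrow> ('h \<times> 'h set \<Rightarrow> rat) set" where
  "tens_rel form = qspan {delta (z, setplus A C) - delta (z, A) - delta (z, C) | z A C.
      z \<in> kerf form \<and> A \<in> cosets z \<and> C \<in> cosets z}"

end

theory Submission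
  imports Defs
begin

text \<open>
  Both statements are proved by duality: a 2-chain is a boundary iff every 2-cocycle vanishes on it,
  and an element of the span of the tensor relations is recognised by the additive functionals.
  Write \<open>K\<close> for the kernel of the form and \<open>S\<close> for its complement. A 2-cocycle \<open>a\<close> on \<open>\<rat>[S]\<close> splits
  by the degree \<open>s = x + y\<close> of \<open>[x] \<and> [y]\<close>. In a degree \<open>s\<close> outside \<open>K\<close> it is a multiple of the form, hence
  vanishes on cycles. In a degree \<open>z \<in> K\<close> the cocycle condition says that \<open>x \<mapsto> a([x] \<and> [z - x])\<close> is
  additive on pairs with nonzero pairing; choosing auxiliary elements in general position extends
  it to an additive map on the whole group that kills \<open>z\<close>, i.e. to a functional on
  \<open>\<rat> \<otimes> H/\<int>z\<close>. On the full algebra a cocycle vanishes on \<open>[s] \<and> [k]\<close> for \<open>s \<in> S\<close>, \<open>k \<in> K\<close>, because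
  \<open>[s]\<close> is a bracket and \<open>[k]\<close> is central, and it is unconstrained on \<open>[k] \<and> [k']\<close>.
\<close>

section \<open>Finitely supported functions and their functionals\<close>

lemma smultf_apply [simp]: "(c *s f) x = c * f x"
  by (simp add: smultf_def)

interpretation qfun: vector_space "smultf :: rat \<Rightarrow> ('a \<Rightarrow> rat) \<Rightarrow> 'a \<Rightarrow> rat"
  by unfold_locales (simp_all add: fun_eq_iff algebra_simps)

lemma vector_space_pair_functional:
  "vector_space_pair (smultf :: rat \<Rightarrow> ('a \<Rightarrow> rat) \<Rightarrow> 'a \<Rightarrow> rat) ((*) :: rat \<Rightarrow> rat \<Rightarrow> rat)"
  by unfold_locales (simp_all add: algebra_simps)

lemma qspan_eq_span: "qspan G = qfun.span G"
  unfolding qspan_def qfun.span_explicit by blast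

lemma sum_fun_apply: "(\<Sum>a\<in>A. f a) x = (\<Sum>a\<in>A. f a x :: rat)"
  by (induction A rule: infinite_finite_induct) auto

lemma fsupp_iff: "x \<in> fsupp f \<longleftrightarrow> f x \<noteq> 0"
  by (simp add: fsupp_def)

lemma fsupp_delta [simp]: "fsupp (delta a) = {a}"
  by (auto simp: fsupp_def delta_def)

lemma subspace_finsupp_on: "qfun.subspace (finsupp_on S)"
proof (rule qfun.subspaceI)
  show "0 \<in> finsupp_on S" by (simp add: finsupp_on_def fsupp_def)
next
  fix f g :: "'a \<Rightarrow> rat"
  assume "f \<in> finsupp_on S" "g \<in> finsupp_on S"
  moreover have "fsupp (f + g) \<subseteq> fsupp f \<union> fsupp g" by (auto simp: fsupp_def)
  ultimately show "f + g \<in> finsupp_on S"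
    by (auto simp: finsupp_on_def intro: finite_subset)
next
  fix c and f :: "'a \<Rightarrow> rat"
  assume "f \<in> finsupp_on S"
  moreover have "fsupp (c *s f) \<subseteq> fsupp f" by (auto simp: fsupp_def)
  ultimately show "c *s f \<in> finsupp_on S"
    by (auto simp: finsupp_on_def intro: finite_subset)
qed

lemma delta_in_finsupp_on: "delta a \<in> finsupp_on S \<longleftrightarrow> a \<in> S"
  by (simp add: finsupp_on_def)

lemma finsupp_on_mono: "S \<subseteq> T \<Longrightarrow> finsupp_on S \<subseteq> finsupp_on T"
  by (auto simp: finsupp_on_def)

lemma finsupp_on_decompose:
  assumes "f \<in> finsupp_on S"
  shows "f = (\<Sum>a\<in>fsupp f. f a *s delta a)"
proof
  fix x
  have "finite (fsupp f)" using assms by (simp add: finsupp_on_def)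
  then show "f x = (\<Sum>a\<in>fsupp f. f a *s delta a) x"
    by (auto simp: sum_fun_apply delta_def fsupp_iff if_distrib[of "\<lambda>r. _ * r"] cong: if_cong)
qed

section \<open>Functionals and linear maps given by their values on the basis\<close>

definition pair :: "('a \<Rightarrow> rat) \<Rightarrow> ('a \<Rightarrow> rat) \<Rightarrow> rat" where
  "pair f w = (\<Sum>p\<in>fsupp w. w p * f p)"

definition lin :: "('a \<Rightarrow> 'b \<Rightarrow> rat) \<Rightarrow> ('a \<Rightarrow> rat) \<Rightarrow> 'b \<Rightarrow> rat" where
  "lin g w = (\<Sum>p\<in>fsupp w. w p *s g p)"

lemma pair_superset: "finite T \<Longrightarrow> fsupp w \<subseteq> T \<Longrightarrow> pair f w = (\<Sum>p\<in>T. w p * f p)"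
  unfolding pair_def by (rule sum.mono_neutral_left) (auto simp: fsupp_def)

lemma lin_apply: "lin g w q = pair (\<lambda>p. g p q) w"
  by (simp add: lin_def pair_def sum_fun_apply)

lemma pair_linear:
  assumes "u \<in> finsupp_on S" "v \<in> finsupp_on S"
  shows "pair f (c *s u + v) = c * pair f u + pair f v"
proof -
  let ?T = "fsupp u \<union> fsupp v"
  have T: "finite ?T" using assms by (simp add: finsupp_on_def)
  have "fsupp (c *s u + v) \<subseteq> ?T" by (auto simp: fsupp_def)
  then show ?thesis
    by (simp add: pair_superset[OF T] sum_distrib_left sum.distrib[symmetric] algebra_simps)
qed

lemma pair_zero [simp]: "pair f 0 = 0"
  by (simp add: pair_def fsupp_def)

lemma pair_delta [simp]: "pair f (delta a) = f a"
  by (simp add: pair_def) (simp add: delta_def)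

lemma pair_cong: "(\<And>p. w p \<noteq> 0 \<Longrightarrow> f p = g p) \<Longrightarrow> pair f w = pair g w"
  unfolding pair_def by (rule sum.cong) (auto simp: fsupp_def)

lemma pair_add:
  assumes "u \<in> finsupp_on UNIV" "v \<in> finsupp_on UNIV"
  shows "pair f (u + v) = pair f u + pair f v"
  using pair_linear[OF assms, of f 1] by simp

lemma pair_scale:
  assumes "u \<in> finsupp_on UNIV"
  shows "pair f (c *s u) = c * pair f u"
  using pair_linear[OF assms, of 0 f c] qfun.subspace_0[OF subspace_finsupp_on, of UNIV] by simp

lemma pair_diff:
  assumes "u \<in> finsupp_on UNIV" "v \<in> finsupp_on UNIV"
  shows "pair f (u - v) = pair f u - pair f v"
  using pair_linear[OF assms(2,1), of f "-1"] by simp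

lemma pair_uminus:
  assumes "u \<in> finsupp_on UNIV"
  shows "pair f (- u) = - pair f u"
  using pair_scale[OF assms, of f "-1"] by simp

lemma pair_sum:
  assumes "\<And>i. i \<in> I \<Longrightarrow> g i \<in> finsupp_on UNIV"
  shows "pair f (\<Sum>i\<in>I. g i) = (\<Sum>i\<in>I. pair f (g i))"
  using assms
  by (induction I rule: infinite_finite_induct)
    (auto simp: pair_add qfun.subspace_sum[OF subspace_finsupp_on])

lemma lin_linear:
  assumes "u \<in> finsupp_on S" "v \<in> finsupp_on S"
  shows "lin g (c *s u + v) = c *s lin g u + lin g v"
  by (simp add: fun_eq_iff lin_apply pair_linear[OF assms])

lemma lin_delta [simp]: "lin g (delta a) = g a"
  by (simp add: fun_eq_iff lin_apply)

lemma lin_in_subspace: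
  assumes "qfun.subspace V" "\<And>p. w p \<noteq> 0 \<Longrightarrow> g p \<in> V"
  shows "lin g w \<in> V"
  unfolding lin_def using assms
  by (auto intro!: qfun.subspace_sum qfun.subspace_scale simp: fsupp_def)

lemma pair_lin:
  assumes "\<And>p. w p \<noteq> 0 \<Longrightarrow> g p \<in> finsupp_on UNIV"
  shows "pair f (lin g w) = pair (\<lambda>p. pair f (g p)) w"
proof -
  have "pair f (lin g w) = (\<Sum>p\<in>fsupp w. pair f (w p *s g p))"
    unfolding lin_def using assms
    by (intro pair_sum qfun.subspace_scale[OF subspace_finsupp_on]) (simp add: fsupp_iff)
  also have "\<dots> = pair (\<lambda>p. pair f (g p)) w"
    unfolding pair_def[of _ w] using assms by (intro sum.cong) (simp_all add: fsupp_iff pair_scale)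
  finally show ?thesis .
qed

text \<open>Finite support makes \<open>v\<close> a finite combination of the
  \<open>delta a\<close>, so arbitrary functions on the index set account for all
  functionals.\<close>

lemma functional_eq_pair:
  assumes "Vector_Spaces.linear smultf (*) \<phi>" "v \<in> finsupp_on S"
  shows "\<phi> v = pair (\<lambda>a. \<phi> (delta a)) v"
proof -
  interpret \<phi>: Vector_Spaces.linear smultf "(*)" \<phi> by fact
  have "\<phi> v = \<phi> (\<Sum>a\<in>fsupp v. v a *s delta a)"
    using finsupp_on_decompose[OF assms(2)] by simp
  also have "\<dots> = pair (\<lambda>a. \<phi> (delta a)) v"
    by (simp add: \<phi>.sum \<phi>.scale pair_def)
  finally show ?thesis .
qed

text \<open>For the converse, a \<open>v\<close> outside the span is adjoined to a maximal
  independent subset of \<open>G\<close>; the functional that is 1 on \<open>v\<close> and 0 on that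
  subset kills \<open>G\<close> but not \<open>v\<close>. Boundaries and tensor relations are both
  tested this way.\<close>

lemma span_iff_pair:
  fixes v :: "'a \<Rightarrow> rat"
  assumes G: "G \<subseteq> finsupp_on UNIV" and v: "v \<in> finsupp_on UNIV"
  shows "v \<in> qfun.span G \<longleftrightarrow> (\<forall>f. (\<forall>g\<in>G. pair f g = 0) \<longrightarrow> pair f v = 0)"
proof
  assume "v \<in> qfun.span G"
  then obtain t r where t: "finite t" "t \<subseteq> G" "v = (\<Sum>b\<in>t. r b *s b)"
    unfolding qfun.span_explicit by blast
  have b: "b \<in> finsupp_on UNIV" if "b \<in> t" for b using that t(2) G by blast
  show "\<forall>f. (\<forall>g\<in>G. pair f g = 0) \<longrightarrow> pair f v = 0"
  proof (intro allI impI)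
    fix f assume f: "\<forall>g\<in>G. pair f g = 0"
    have "pair f v = (\<Sum>b\<in>t. pair f (r b *s b))"
      unfolding t(3) using b by (intro pair_sum qfun.subspace_scale[OF subspace_finsupp_on])
    also have "\<dots> = 0" using b f t(2) by (intro sum.neutral) (auto simp: pair_scale)
    finally show "pair f v = 0" .
  qed
next
  assume *: "\<forall>f. (\<forall>g\<in>G. pair f g = 0) \<longrightarrow> pair f v = 0"
  show "v \<in> qfun.span G"
  proof (rule ccontr)
    assume nv: "v \<notin> qfun.span G"
    interpret qfunctional: vector_space_pair "smultf :: rat \<Rightarrow> ('a \<Rightarrow> rat) \<Rightarrow> 'a \<Rightarrow> rat" "(*)"
      by (rule vector_space_pair_functional)
    obtain B where B: "B \<subseteq> G" "qfun.independent B" "G \<subseteq> qfun.span B"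
      using qfun.maximal_independent_subset by blast
    have vB: "v \<notin> qfun.span B" using nv B(1) qfun.span_mono by blast
    then have ind: "qfun.independent (insert v B)" using B(2) by (rule qfun.independent_insertI)
    define \<phi> where "\<phi> = qfunctional.construct (insert v B) (\<lambda>x. if x = v then 1 else 0)"
    have lin: "Vector_Spaces.linear smultf (*) \<phi>"
      unfolding \<phi>_def by (rule qfunctional.linear_construct[OF ind])
    have "\<phi> v = 1" unfolding \<phi>_def by (simp add: qfunctional.construct_basis[OF ind])
    moreover have "\<phi> g = 0" if "g \<in> G" for g
    proof -
      have "\<phi> b = 0" if "b \<in> B" for b
        unfolding \<phi>_def using that vB qfun.span_base[of v B]
        by (auto simp: qfunctional.construct_basis[OF ind])
      then show ?thesis
        using qfunctional.linear_eq_0_on_span[OF lin] that B(3) by blast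
    qed
    ultimately show False
      using * G v functional_eq_pair[OF lin]
      by (metis (no_types, lifting) subsetD zero_neq_one)
  qed
qed

lemma pair_add_left: "pair (\<lambda>p. f p + r * g p) w = pair f w + r * pair g w"
  by (simp add: pair_def algebra_simps sum.distrib sum_distrib_left)

lemma lin_add:
  "u \<in> finsupp_on UNIV \<Longrightarrow> v \<in> finsupp_on UNIV \<Longrightarrow> lin g (u + v) = lin g u + lin g v"
  by (simp add: fun_eq_iff lin_apply pair_add)

lemma lin_diff:
  "u \<in> finsupp_on UNIV \<Longrightarrow> v \<in> finsupp_on UNIV \<Longrightarrow> lin g (u - v) = lin g u - lin g v"
  by (simp add: fun_eq_iff lin_apply pair_diff)

lemma lin_scale: "u \<in> finsupp_on UNIV \<Longrightarrow> lin g (c *s u) = c *s lin g u"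
  by (simp add: fun_eq_iff lin_apply pair_scale)

lemmas finsupp_UNIV_intros =
  qfun.subspace_add[OF subspace_finsupp_on] qfun.subspace_diff[OF subspace_finsupp_on]
  qfun.subspace_neg[OF subspace_finsupp_on] qfun.subspace_scale[OF subspace_finsupp_on]
  qfun.subspace_0[OF subspace_finsupp_on]
  delta_in_finsupp_on[of _ UNIV, simplified]

lemmas pair_simps = pair_add pair_diff pair_uminus pair_scale finsupp_UNIV_intros

section \<open>Alternating forms and cocycles\<close>

text \<open>Each of the progressions \<open>a + i p\<close> and \<open>b + i q\<close> vanishes for
  at most one \<open>i\<close>, so one of three consecutive indices avoids both zeros.\<close>

lemma nonzero_pair_of_three:
  fixes a b p q :: int
  assumes "p \<noteq> 0" "q \<noteq> 0"
  shows "(a \<noteq> 0 \<and> b \<noteq> 0) \<or> (a + p \<noteq> 0 \<and> b + q \<noteq> 0) \<or> (a + p + p \<noteq> 0 \<and> b + q + q \<noteq> 0)"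
  using assms by (cases "a = 0"; cases "b = 0"; cases "a + p = 0"; cases "b + q = 0") auto

locale alternating_form =
  fixes form :: "'h::ab_group_add \<Rightarrow> 'h \<Rightarrow> int"
  assumes add_left: "form (x + y) z = form x z + form y z"
    and add_right: "form x (y + z) = form x y + form x z"
    and self: "form x x = 0"
begin

abbreviation K :: "'h set" where "K \<equiv> kerf form"
abbreviation S :: "'h set" where "S \<equiv> UNIV - kerf form"

lemma swap: "form y x = - form x y"
  using self[of "x + y"] self[of x] self[of y] unfolding add_left add_right by linarith

lemma zero_left: "form 0 x = 0"
  using add_left[of 0 0 x] by simp

lemma zero_right: "form x 0 = 0"
  using swap[of x 0] by (simp add: zero_left)

lemma minus_left: "form (- x) y = - form x y"
  using add_left[of "- x" x y] by (simp add: zero_left)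

lemma minus_right: "form x (- y) = - form x y"
  using swap[of x "- y"] swap[of x y] by (simp add: minus_left)

lemma diff_left: "form (x - y) z = form x z - form y z"
  using add_left[of x "- y" z] by (simp add: minus_left)

lemma diff_right: "form x (y - z) = form x y - form x z"
  using add_right[of x y "- z"] by (simp add: minus_right)

lemmas form_simps = add_left add_right zero_left zero_right minus_left minus_right
  diff_left diff_right self

lemma S_iff: "x \<in> S \<longleftrightarrow> (\<exists>y. form x y \<noteq> 0)"
  by (simp add: kerf_def)

lemma in_S: "form x y \<noteq> 0 \<Longrightarrow> x \<in> S" "form y x \<noteq> 0 \<Longrightarrow> x \<in> S"
  unfolding S_iff by (blast, metis swap neg_equal_0_iff_equal)

lemma S_partner: "x \<in> S \<Longrightarrow> \<exists>y. form y x \<noteq> 0"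
  by (metis S_iff swap neg_equal_0_iff_equal)

lemma K_left: "x \<in> K \<Longrightarrow> form x y = 0"
  by (simp add: kerf_def)

lemma K_right: "x \<in> K \<Longrightarrow> form y x = 0"
  using swap[of y x] by (simp add: K_left)

lemma S_minus: "x \<in> S \<Longrightarrow> - x \<in> S"
  by (simp add: kerf_def minus_left)

lemma K_diff_S: "x \<in> K \<Longrightarrow> y \<in> S \<Longrightarrow> x - y \<in> S"
  by (simp add: kerf_def diff_left)

text \<open>A group is not a union of two proper subgroups; here these are the annihilators of
  \<open>x\<close> and of \<open>y\<close>.\<close>

lemma common_partner2:
  assumes "x \<in> S" "y \<in> S"
  obtains u where "form x u \<noteq> 0" "form y u \<noteq> 0"
proof -
  obtain p q where p: "form x p \<noteq> 0" and q: "form y q \<noteq> 0"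
    using assms unfolding S_iff by blast
  consider "form y p \<noteq> 0" | "form x q \<noteq> 0" | "form y p = 0" "form x q = 0" by blast
  then show thesis
    by cases (use p q that[of p] that[of q] that[of "p + q"] in \<open>auto simp: add_right\<close>)
qed

text \<open>If the partner \<open>p\<close> of \<open>x\<close> and \<open>y\<close> fails for
  \<open>v\<close>, then every \<open>q + i p\<close> pairs with \<open>v\<close> as
  \<open>q\<close> does, and \<open>nonzero_pair_of_three\<close> picks an \<open>i\<close> that
  also suits \<open>x\<close> and \<open>y\<close>.\<close>

lemma common_partner3:
  assumes "x \<in> S" "y \<in> S" "v \<in> S"
  obtains u where "form x u \<noteq> 0" "form y u \<noteq> 0" "form v u \<noteq> 0"
proof -
  obtain p where p: "form x p \<noteq> 0" "form y p \<noteq> 0" using common_partner2 assms by blast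
  obtain q where q: "form v q \<noteq> 0" using assms unfolding S_iff by blast
  consider "form v p \<noteq> 0" | "form v p = 0" "form x q \<noteq> 0" "form y q \<noteq> 0"
    | "form v p = 0" "form x (q + p) \<noteq> 0" "form y (q + p) \<noteq> 0"
    | "form v p = 0" "form x (q + p + p) \<noteq> 0" "form y (q + p + p) \<noteq> 0"
    using nonzero_pair_of_three[OF p, of "form x q" "form y q"] unfolding add_right by blast
  then show thesis
    by cases (use p q that[of p] that[of q] that[of "q + p"] that[of "q + p + p"]
      in \<open>auto simp: add_right\<close>)
qed

text \<open>One \<open>v\<close> with \<open>form s\<^sub>0 v\<close> nonzero certifies all three
  memberships. The candidates for \<open>u\<close> are one, two and three times
  \<open>s\<^sub>0\<close>, of which \<open>a\<close> and \<open>b\<close> exclude at most one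
  each.\<close>

lemma ex_translate_in_S:
  assumes s\<^sub>0: "s\<^sub>0 \<in> S"
  shows "\<exists>u. u \<in> S \<and> u + a \<in> S \<and> u + b \<in> S"
proof -
  obtain v where v: "form s\<^sub>0 v \<noteq> 0" using s\<^sub>0 unfolding S_iff by blast
  have "\<exists>u. form u v \<noteq> 0 \<and> form (u + a) v \<noteq> 0 \<and> form (u + b) v \<noteq> 0"
  proof -
    have "(form (s\<^sub>0 + a) v \<noteq> 0 \<and> form (s\<^sub>0 + b) v \<noteq> 0)
      \<or> (form (s\<^sub>0 + s\<^sub>0 + a) v \<noteq> 0 \<and> form (s\<^sub>0 + s\<^sub>0 + b) v \<noteq> 0)
      \<or> (form (s\<^sub>0 + s\<^sub>0 + s\<^sub>0 + a) v \<noteq> 0 \<and> form (s\<^sub>0 + s\<^sub>0 + s\<^sub>0 + b) v \<noteq> 0)"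
      using nonzero_pair_of_three[OF v v, of "form s\<^sub>0 v + form a v" "form s\<^sub>0 v + form b v"]
      unfolding add_left by (simp only: ac_simps)
    moreover have "form (s\<^sub>0 + s\<^sub>0) v \<noteq> 0" "form (s\<^sub>0 + s\<^sub>0 + s\<^sub>0) v \<noteq> 0"
      using v by (auto simp: add_left)
    ultimately show ?thesis using v by blast
  qed
  then show ?thesis using in_S(1) by blast
qed

text \<open>Here \<open>e x\<close> stands for the value on \<open>[x] \<and> [z - x]\<close> of a 2-cocycle, for central \<open>z\<close>.\<close>

context
  fixes z :: 'h and e :: "'h \<Rightarrow> rat" and s\<^sub>0 :: 'h
  assumes z: "z \<in> K" and s\<^sub>0: "s\<^sub>0 \<in> S"
    and e_compl: "\<And>x. x \<in> S \<Longrightarrow> e (z - x) = - e x"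
    and e_add: "\<And>x y. form x y \<noteq> 0 \<Longrightarrow> e (x + y) = e x + e y"
begin

text \<open>If \<open>x\<close> and \<open>y\<close> are orthogonal, a \<open>u\<close> that pairs
  with \<open>x\<close>, \<open>y\<close> and \<open>x + y\<close> allows
  \<open>e (x + y + u)\<close> to be expanded in two ways through nonzero pairings.\<close>

lemma e_additive_on_S:
  assumes x: "x \<in> S" and y: "y \<in> S" and xy: "x + y \<in> S"
  shows "e (x + y) = e x + e y"
proof (cases "form x y = 0")
  case True
  obtain u where u: "form x u \<noteq> 0" "form y u \<noteq> 0" "form (x + y) u \<noteq> 0"
    using common_partner3[OF assms] by blast
  have "e (x + y) + e u = e (x + (y + u))"
    using e_add[OF u(3)] by (simp add: add.assoc)
  also have "\<dots> = e x + e (y + u)"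
    using u True by (intro e_add) (simp add: add_right)
  also have "e (y + u) = e y + e u" using u by (intro e_add)
  finally show ?thesis by simp
qed (rule e_add)

text \<open>When \<open>u\<close> and \<open>v\<close> pair nontrivially,
  \<open>e (x + u + v)\<close> is expanded with \<open>x\<close> attached to either of them; a
  common partner links the general case.\<close>

lemma e_shift_central:
  assumes x: "x \<in> K" and u: "u \<in> S" and v: "v \<in> S"
  shows "e (x + u) - e u = e (x + v) - e v"
proof -
  have *: "e (x + u) - e u = e (x + v) - e v" if "form u v \<noteq> 0" for u v
  proof -
    have "e ((x + u) + v) = e (x + u) + e v"
      using that x by (intro e_add) (simp add: add_left K_left)
    moreover have "e (u + (x + v)) = e u + e (x + v)"
      using that x by (intro e_add) (simp add: add_right K_right)
    ultimately show ?thesis by (simp add: algebra_simps)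
  qed
  obtain w where "form u w \<noteq> 0" "form v w \<noteq> 0" using common_partner2 u v by blast
  then show ?thesis using *[of u w] *[of v w] by simp
qed

lemma e_extends_additively:
  "\<exists>\<phi>. (\<forall>x y. \<phi> (x + y) = \<phi> x + \<phi> y) \<and> \<phi> z = 0 \<and> (\<forall>x\<in>S. \<phi> x = e x)"
proof -
  \<comment> \<open>The hypotheses say nothing about \<open>e\<close> on the kernel, so the value
    there is the one additivity forces; by \<open>e_shift_central\<close> the choice of
    \<open>s\<^sub>0\<close> is immaterial.\<close>
  define \<phi> where "\<phi> x = (if x \<in> S then e x else e (x + s\<^sub>0) - e s\<^sub>0)" for x
  have \<phi>: "\<phi> x = e (x + u) - e u" if "u \<in> S" "x + u \<in> S" for x u
    using that e_additive_on_S[of x u] e_shift_central[of x u s\<^sub>0] s\<^sub>0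
    by (cases "x \<in> S") (auto simp: \<phi>_def)
  have "\<phi> (x + y) = \<phi> x + \<phi> y" for x y
  proof -
    \<comment> \<open>With all three translates outside the kernel, the differences of
      \<open>e\<close> that compute the three values of \<open>\<phi>\<close> telescope.\<close>
    obtain u where u: "u \<in> S" "u + y \<in> S" "u + (x + y) \<in> S"
      using ex_translate_in_S[OF s\<^sub>0] by blast
    then show ?thesis
      using \<phi>[of u "x + y"] \<phi>[of u y] \<phi>[of "u + y" x] by (simp add: ac_simps)
  qed
  \<comment> \<open>The value is \<open>e (z + s\<^sub>0) - e s\<^sub>0\<close>;
    \<open>e_compl\<close> at \<open>- s\<^sub>0\<close> makes the first term
    \<open>- e (- s\<^sub>0)\<close>, and additivity makes \<open>e\<close> odd at
    \<open>s\<^sub>0\<close>.\<close>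
  moreover have "\<phi> z = 0"
  proof -
    obtain u where u: "form u s\<^sub>0 \<noteq> 0" using S_partner[OF s\<^sub>0] by blast
    have "e (u + s\<^sub>0 + - s\<^sub>0) = e (u + s\<^sub>0) + e (- s\<^sub>0)"
      using u by (intro e_add) (simp add: form_simps)
    also have "e (u + s\<^sub>0) = e u + e s\<^sub>0" using u by (rule e_add)
    finally have "e (- s\<^sub>0) = - e s\<^sub>0" by simp
    moreover have "e (z - - s\<^sub>0) = - e (- s\<^sub>0)" by (rule e_compl) (use s\<^sub>0 S_minus in blast)
    ultimately show ?thesis using z by (simp add: \<phi>_def)
  qed
  ultimately show ?thesis by (intro exI[of _ \<phi>]) (simp add: \<phi>_def)
qed

end

text \<open>For alternating \<open>a\<close>, the expression is the pairing with
  \<open>bd3_basis\<close> up to a factor -2, see \<open>pair_bd3_basis\<close>.\<close>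

definition cocycle :: "'h set \<Rightarrow> ('h \<times> 'h \<Rightarrow> rat) \<Rightarrow> bool" where
  "cocycle T a \<longleftrightarrow> (\<forall>x y. a (x, y) = - a (y, x)) \<and>
     (\<forall>x\<in>T. \<forall>y\<in>T. \<forall>w\<in>T. of_int (form x y) * a (x + y, w)
        - of_int (form x w) * a (x + w, y) + of_int (form y w) * a (y + w, x) = 0)"

lemma cocycle_alt: "cocycle T a \<Longrightarrow> a (y, x) = - a (x, y)"
  unfolding cocycle_def by blast

lemma cocycleD:
  "cocycle T a \<Longrightarrow> x \<in> T \<Longrightarrow> y \<in> T \<Longrightarrow> w \<in> T \<Longrightarrow> of_int (form x y) * a (x + y, w)
    - of_int (form x w) * a (x + w, y) + of_int (form y w) * a (y + w, x) = 0"
  unfolding cocycle_def by blast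

text \<open>On a triple with central sum the three pairings agree up to sign, so a nonzero
  \<open>form x y\<close> cancels from the cocycle identity and leaves additivity.\<close>

lemma cocycle_central_degree:
  assumes a: "cocycle S a" and z: "z \<in> K" and nz: "S \<noteq> {}"
  shows "\<exists>\<phi>. (\<forall>x y. \<phi> (x + y) = \<phi> x + \<phi> y) \<and> \<phi> z = 0 \<and> (\<forall>x\<in>S. \<phi> x = a (x, z - x))"
proof -
  obtain s\<^sub>0 where s\<^sub>0: "s\<^sub>0 \<in> S" using nz by blast
  show ?thesis
  proof (rule e_extends_additively[OF z s\<^sub>0, of "\<lambda>x. a (x, z - x)"])
    show "a (z - x, z - (z - x)) = - a (x, z - x)" for x
      using cocycle_alt[OF a, of "z - x" x] by simp
  next
    fix x y assume xy: "form x y \<noteq> 0"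
    define w where "w = z - x - y"
    have w: "form x w = - form x y" "form y w = form x y"
      using z K_right swap[of y x] by (simp_all add: w_def form_simps)
    have S: "x \<in> S" "y \<in> S" "w \<in> S"
      using xy w in_S[of x y] in_S[of y x] in_S(2)[of x w] by auto
    have "x + w = z - y" "y + w = z - x" by (simp_all add: w_def)
    then have "of_int (form x y) * (a (x + y, w) + a (z - y, y) + a (z - x, x)) = 0"
      using cocycleD[OF a S] w by (simp add: distrib_left)
    then have "a (x + y, w) + a (z - y, y) + a (z - x, x) = 0" using xy by simp
    then show "a (x + y, z - (x + y)) = a (x, z - x) + a (y, z - y)"
      using cocycle_alt[OF a, of "z - y" y] cocycle_alt[OF a, of "z - x" x]
      by (simp add: w_def diff_diff_eq)
  qed
qed

text \<open>After subtracting a multiple of the coboundary \<open>form\<close> one may assume that the cocycle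
  vanishes at \<open>u\<close>; \<open>f x\<close> is then its value on \<open>[x] \<and> [s - x]\<close>. The relations for the triples
  containing \<open>u\<close> or \<open>2u\<close> force \<open>f = 0\<close>.\<close>

lemma cocycle_noncentral_degree:
  assumes a: "cocycle S a" and s: "s \<in> S"
  shows "\<exists>c. \<forall>x\<in>S. s - x \<in> S \<longrightarrow> a (x, s - x) = c * of_int (form x s)"
proof -
  obtain u where u: "form u s \<noteq> 0" using S_partner[OF s] by blast
  define c where "c = a (u, s - u) / of_int (form u s)"
  define f where "f x = a (x, s - x) - c * of_int (form x s)" for x
  have fu: "f u = 0" using u by (simp add: f_def c_def)
  have fs: "f (s - x) = - f x" for x
    using cocycle_alt[OF a, of "s - x" x] by (simp add: f_def form_simps)
  \<comment> \<open>The cocycle identity on \<open>x\<close>, \<open>y\<close>,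
    \<open>s - x - y\<close>; the contribution of \<open>c\<close> cancels because
    \<open>form\<close> is a coboundary.\<close>
  have R: "of_int (form x y) * (f x + f y - f (x + y)) + of_int (form y s) * f x
      - of_int (form x s) * f y = 0" if S: "x \<in> S" "y \<in> S" "s - x - y \<in> S" for x y
  proof -
    have "x + (s - x - y) = s - y" "y + (s - x - y) = s - x" "s - x - y = s - (x + y)"
      by (simp_all add: algebra_simps)
    then show ?thesis
      using cocycleD[OF a S] cocycle_alt[OF a, of "s - y" y] cocycle_alt[OF a, of "s - x" x] swap[of x y]
      by (simp add: f_def form_simps) (simp add: algebra_simps)
  qed
  have us: "form (u + u) s \<noteq> 0" using u by (simp add: add_left)
  have uS: "u \<in> S" "u + u \<in> S" using u us in_S(1) by blast+
  \<comment> \<open>\<open>R\<close> is applied to \<open>u\<close> and \<open>u + u\<close>, whose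
    pairing is zero; what remains ties \<open>f (u + u)\<close> to \<open>f u\<close>.\<close>
  have f2u: "f (u + u) = 0"
  proof -
    have "form (s - u - (u + u)) s \<noteq> 0" using u by (simp add: form_simps)
    then have "s - u - (u + u) \<in> S" by (rule in_S(1))
    from R[OF uS this] show ?thesis using fu u by (simp add: form_simps)
  qed
  have Ru: "of_int (form x u) * (f x - f (x + u)) = of_int (form s u) * f x"
    if "x \<in> S" "s - x - u \<in> S" for x
    using R[OF that(1) uS(1) that(2)] fu swap[of s u] by (simp add: algebra_simps)
  have R2u: "of_int (form x u) * (f x - f (x + u + u)) = of_int (form s u) * f x"
    if "x \<in> S" "s - x - (u + u) \<in> S" for x
    using R[OF that(1) uS(2) that(2)] f2u swap[of s u] by (simp add: form_simps algebra_simps)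
  have su: "form s u \<noteq> 0" using u swap[of s u] by simp
  \<comment> \<open>The left side of \<open>Ru\<close> vanishes while \<open>form s u\<close> does
    not; pairing with \<open>u\<close> also shows that \<open>s - x - u\<close> lies in
    \<open>S\<close>.\<close>
  have f0: "f x = 0" if "x \<in> S" "form x u = 0" for x
  proof -
    have "form (s - x - u) u \<noteq> 0" using su that by (simp add: form_simps)
    then show ?thesis using Ru[of x] that su in_S(1) by auto
  qed
  have "f x = 0" if x: "x \<in> S" "s - x \<in> S" for x
  proof -
    consider "form x u = 0" | "form x u = form s u" | "form x u \<noteq> 0" "form x u \<noteq> form s u" by blast
    then show ?thesis
    proof cases
      case 1 then show ?thesis using f0 x by blast
    next
      case 2
      then have "f (s - x) = 0" using f0 x by (simp add: diff_left)
      then show ?thesis using fs by simp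
    next
      case 3
      have "form (x + u) u \<noteq> 0" "form (s - x - u) u \<noteq> 0" "form (s - x - (u + u)) u \<noteq> 0"
        "form (s - (x + u) - u) u \<noteq> 0"
        using 3 by (simp_all add: form_simps)
      then have S: "x + u \<in> S" "s - x - u \<in> S" "s - x - (u + u) \<in> S" "s - (x + u) - u \<in> S"
        using in_S(1) by blast+
      \<comment> \<open>The first two relations give \<open>f (x + u) = f (x + u + u)\<close>. Then
        the third forces \<open>f (x + u) = 0\<close>, and the first leaves \<open>f x\<close> times
        the nonzero factor \<open>form x u - form s u\<close>.\<close>
      note r = Ru[OF x(1) S(2)] R2u[OF x(1) S(3)] Ru[OF S(1,4)]
      have "of_int (form x u) * (f x - f (x + u)) = of_int (form x u) * (f x - f (x + u + u))"
        using r(1,2) by (rule trans[OF _ sym])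
      then have "f (x + u) = f (x + u + u)" using 3(1) by simp
      then have "f (x + u) = 0" using r(3) su by simp
      then show ?thesis using r(1) 3(2) by simp
    qed
  qed
  then show ?thesis by (intro exI[of _ c]) (simp add: f_def)
qed

end

section \<open>Boundaries detected by cocycles\<close>

lemma C2_finsupp: "w \<in> C2 T \<Longrightarrow> w \<in> finsupp_on UNIV"
  using finsupp_on_mono[of "T \<times> T" UNIV] unfolding C2_def by blast

lemma C2_supp: "w \<in> C2 T \<Longrightarrow> w (x, y) \<noteq> 0 \<Longrightarrow> x \<in> T \<and> y \<in> T"
  unfolding C2_def finsupp_on_def fsupp_def by blast

lemma C2_alt: "w \<in> C2 T \<Longrightarrow> w (y, x) = - w (x, y)"
  unfolding C2_def by blast

text \<open>Arbitrary index maps let one statement serve \<open>C2\<close> and both transpositions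
  in \<open>C3\<close>.\<close>

lemma subspace_antisymmetric: "qfun.subspace {w. \<forall>i. w (\<sigma> i) = - w (\<tau> i)}"
proof (rule qfun.subspaceI)
  fix u v :: "'a \<Rightarrow> rat"
  assume u: "u \<in> {w. \<forall>i. w (\<sigma> i) = - w (\<tau> i)}" and v: "v \<in> {w. \<forall>i. w (\<sigma> i) = - w (\<tau> i)}"
  have "(u + v) (\<sigma> i) = - (u + v) (\<tau> i)" for i
    using u[simplified, THEN spec, of i] v[simplified, THEN spec, of i] by simp
  then show "u + v \<in> {w. \<forall>i. w (\<sigma> i) = - w (\<tau> i)}" by blast
next
  fix c and u :: "'a \<Rightarrow> rat"
  assume u: "u \<in> {w. \<forall>i. w (\<sigma> i) = - w (\<tau> i)}"
  have "(c *s u) (\<sigma> i) = - (c *s u) (\<tau> i)" for i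
    using u[simplified, THEN spec, of i] by simp
  then show "c *s u \<in> {w. \<forall>i. w (\<sigma> i) = - w (\<tau> i)}" by blast
qed simp

lemma subspace_C2: "qfun.subspace (C2 T)"
proof -
  have eq: "C2 T = finsupp_on (T \<times> T) \<inter> {w. \<forall>i. w i = - w (snd i, fst i)}"
    unfolding C2_def split_paired_All by (simp only: fst_conv snd_conv) blast
  show ?thesis
    unfolding eq by (intro qfun.subspace_inter subspace_finsupp_on subspace_antisymmetric)
qed

lemma C3_finsupp: "w \<in> C3 T \<Longrightarrow> w \<in> finsupp_on UNIV"
  using finsupp_on_mono[of "T \<times> T \<times> T" UNIV] unfolding C3_def by blast

lemma C3_supp: "w \<in> C3 T \<Longrightarrow> w (x, y, z) \<noteq> 0 \<Longrightarrow> x \<in> T \<and> y \<in> T \<and> z \<in> T"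
  unfolding C3_def finsupp_on_def fsupp_def by blast

lemma subspace_C3: "qfun.subspace (C3 T)"
proof -
  have eq: "C3 T = finsupp_on (T \<times> T \<times> T) \<inter> ({w. \<forall>i. w i = - w (fst (snd i), fst i, snd (snd i))}
      \<inter> {w. \<forall>i. w i = - w (fst i, snd (snd i), fst (snd i))})"
    unfolding C3_def split_paired_All by (simp only: fst_conv snd_conv) blast
  show ?thesis
    unfolding eq by (intro qfun.subspace_inter subspace_finsupp_on subspace_antisymmetric)
qed

lemma wedge2_finsupp: "wedge2 x y \<in> finsupp_on UNIV"
  by (simp add: wedge2_def finsupp_UNIV_intros)

lemma wedge2_in_C2:
  assumes "x \<in> T" "y \<in> T"
  shows "wedge2 x y \<in> C2 T"
proof -
  have "wedge2 x y \<in> finsupp_on (T \<times> T)"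
    unfolding wedge2_def using assms
    by (intro qfun.subspace_diff[OF subspace_finsupp_on]) (simp_all add: delta_in_finsupp_on)
  moreover have "wedge2 x y (p, q) = - wedge2 x y (q, p)" for p q
    by (simp add: wedge2_def delta_def conj_commute)
  ultimately show ?thesis unfolding C2_def by blast
qed

lemma pair_wedge2: "pair a (wedge2 x y) = a (x, y) - a (y, x)"
  by (simp add: wedge2_def pair_simps)

lemma lin_wedge2: "lin g (wedge2 x y) = g (x, y) - g (y, x)"
  by (simp add: wedge2_def lin_diff finsupp_UNIV_intros)

lemma pair_transpose:
  assumes w: "w \<in> C2 T"
  shows "pair (\<lambda>p. f (snd p, fst p)) w = - pair f w"
proof -
  have swap: "w (snd p, fst p) = - w p" for p
    using C2_alt[OF w, of "snd p" "fst p"] by simp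
  have "pair (\<lambda>p. f (snd p, fst p)) w = (\<Sum>p\<in>fsupp w. - (w p * f p))"
    unfolding pair_def
    by (rule sum.reindex_bij_witness[of _ prod.swap prod.swap])
      (simp_all add: fsupp_def prod.swap_def swap)
  then show ?thesis by (simp add: pair_def sum_negf)
qed

text \<open>The six permutations with their signs: the alternating function that represents the
  wedge product of [x], [y] and [z].\<close>

definition wedge3 :: "'h \<Rightarrow> 'h \<Rightarrow> 'h \<Rightarrow> 'h \<times> 'h \<times> 'h \<Rightarrow> rat" where
  "wedge3 x y z = delta (x, y, z) - delta (y, x, z) - delta (x, z, y) - delta (z, y, x)
     + delta (y, z, x) + delta (z, x, y)"

lemma wedge3_in_C3:
  assumes "x \<in> T" "y \<in> T" "z \<in> T"
  shows "wedge3 x y z \<in> C3 T"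
proof -
  have "wedge3 x y z \<in> finsupp_on (T \<times> T \<times> T)"
    unfolding wedge3_def using assms
    by (intro qfun.subspace_diff[OF subspace_finsupp_on] qfun.subspace_add[OF subspace_finsupp_on])
      (simp_all add: delta_in_finsupp_on)
  moreover have "wedge3 x y z (p, q, r) = - wedge3 x y z (q, p, r)"
    "wedge3 x y z (p, q, r) = - wedge3 x y z (p, r, q)" for p q r
    by (simp_all add: wedge3_def delta_def conj_ac)
  ultimately show ?thesis unfolding C3_def by blast
qed

section \<open>Boundary maps as linear extensions\<close>

lemma bd2_lin: "bd2 form w = lin (\<lambda>p. (- 1 / 2) *s gbracket form (fst p) (snd p)) w"
  unfolding bd2_def lin_def by (rule sum.cong) (auto simp: fun_eq_iff)

lemma bd3_lin:
  "bd3 form w = lin (\<lambda>p. (1 / 6) *s bd3_basis form (fst p) (fst (snd p)) (snd (snd p))) w"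
  unfolding bd3_def lin_def by (rule sum.cong) (auto simp: fun_eq_iff)

lemma gbracket_finsupp: "gbracket form x y \<in> finsupp_on UNIV"
  by (simp add: gbracket_def finsupp_UNIV_intros)

lemma bd3_basis_finsupp: "bd3_basis form x y z \<in> finsupp_on UNIV"
  by (simp add: bd3_basis_def finsupp_UNIV_intros wedge2_finsupp)

lemma pair_bd2:
  "pair f (bd2 form w) = pair (\<lambda>(x, y). - of_int (form x y) * f (x + y) / 2) w"
  unfolding bd2_lin
  by (subst pair_lin)
    (auto intro!: pair_cong simp: finsupp_UNIV_intros gbracket_finsupp pair_scale pair_uminus gbracket_def)

lemma bd2_linear:
  assumes "u \<in> finsupp_on UNIV" "v \<in> finsupp_on UNIV"
  shows "bd2 form (c *s u + v) = c *s bd2 form u + bd2 form v"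
  unfolding bd2_lin by (rule lin_linear[OF assms])

lemma subspace_Z2: "qfun.subspace (Z2 form T)"
proof (rule qfun.subspaceI)
  show "0 \<in> Z2 form T"
    using qfun.subspace_0[OF subspace_C2] by (auto simp: Z2_def bd2_def fsupp_def)
  show "u + v \<in> Z2 form T" if "u \<in> Z2 form T" "v \<in> Z2 form T" for u v
    using that qfun.subspace_add[OF subspace_C2] bd2_linear[of u v form 1]
    by (auto simp: Z2_def C2_finsupp)
  show "c *s u \<in> Z2 form T" if "u \<in> Z2 form T" for c u
    using that qfun.subspace_scale[OF subspace_C2]
    by (auto simp: Z2_def bd2_lin lin_scale C2_finsupp)
qed

lemma subspace_B2: "qfun.subspace (B2 form T)"
proof (rule qfun.subspaceI)
  have lin: "bd3 form (c *s u + v) = c *s bd3 form u + bd3 form v"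
    if "u \<in> C3 T" "v \<in> C3 T" for c u v
    unfolding bd3_lin by (rule lin_linear[OF that[THEN C3_finsupp]])
  note C3 = qfun.subspace_0[OF subspace_C3] qfun.subspace_add[OF subspace_C3]
    qfun.subspace_scale[OF subspace_C3]
  have bd3_0: "bd3 form 0 = 0" by (simp add: bd3_def fsupp_def)
  then show "0 \<in> B2 form T" using C3(1) unfolding B2_def by force
  show "u + v \<in> B2 form T" if "u \<in> B2 form T" "v \<in> B2 form T" for u v
  proof -
    obtain u' v' where "u' \<in> C3 T" "v' \<in> C3 T" "u = bd3 form u'" "v = bd3 form v'"
      using \<open>u \<in> _\<close> \<open>v \<in> _\<close> unfolding B2_def by blast
    then show ?thesis using lin[of u' v' 1] C3(2)[of u' T v'] unfolding B2_def by force
  qed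
  show "c *s u \<in> B2 form T" if "u \<in> B2 form T" for c u
  proof -
    obtain u' where "u' \<in> C3 T" "u = bd3 form u'"
      using \<open>u \<in> _\<close> unfolding B2_def by blast
    then show ?thesis using lin[of u' 0 c] C3(1)[of T] C3(3)[of u' T c] bd3_0 unfolding B2_def by force
  qed
qed

context alternating_form
begin

lemma bd3_basis_swap:
  "bd3_basis form y x z = - bd3_basis form x y z" "bd3_basis form x z y = - bd3_basis form x y z"
  by (simp_all add: bd3_basis_def swap[of x y] swap[of y z] add.commute)

text \<open>Each of the six terms, taken with its sign, contributes the same value, which uses up
  the factor 1/6.\<close>

lemma bd3_wedge3: "bd3 form (wedge3 x y z) = bd3_basis form x y z"
proof -
  have "bd3_basis form y x z = - bd3_basis form x y z"
    "bd3_basis form x z y = - bd3_basis form x y z" "bd3_basis form z y x = - bd3_basis form x y z"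
    "bd3_basis form y z x = bd3_basis form x y z" "bd3_basis form z x y = bd3_basis form x y z"
    using bd3_basis_swap(1)[of z y x] bd3_basis_swap(2)[of y z x] bd3_basis_swap(1)[of y x z]
      bd3_basis_swap(1)[of x z y] bd3_basis_swap(2)[of x y z] by simp_all
  then show ?thesis
    unfolding bd3_lin wedge3_def
    by (simp add: lin_add lin_diff finsupp_UNIV_intros) (simp add: fun_eq_iff)
qed

lemma B2_eq_span: "B2 form T = qfun.span {bd3_basis form x y z | x y z. x \<in> T \<and> y \<in> T \<and> z \<in> T}"
  (is "_ = qfun.span ?G")
proof
  show "B2 form T \<subseteq> qfun.span ?G"
  proof
    fix v assume "v \<in> B2 form T"
    then obtain w where w: "w \<in> C3 T" "v = bd3 form w" unfolding B2_def by blast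
    have "bd3_basis form (fst p) (fst (snd p)) (snd (snd p)) \<in> ?G" if "w p \<noteq> 0" for p
      using C3_supp[OF w(1), of "fst p" "fst (snd p)" "snd (snd p)"] that by auto
    then show "v \<in> qfun.span ?G"
      unfolding w(2) bd3_lin
      by (intro lin_in_subspace qfun.subspace_span qfun.span_scale qfun.span_base)
  qed
  have "?G \<subseteq> B2 form T"
    using wedge3_in_C3 unfolding B2_def by (force simp flip: bd3_wedge3)
  then show "qfun.span ?G \<subseteq> B2 form T" by (rule qfun.span_minimal[OF _ subspace_B2])
qed

lemma pair_bd3_basis:
  assumes "\<And>x y. a (x, y) = - a (y, x)"
  shows "pair a (bd3_basis form x y z) = - 2 * (of_int (form x y) * a (x + y, z)
    - of_int (form x z) * a (x + z, y) + of_int (form y z) * a (y + z, x))"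
  using assms[of z "x + y"] assms[of y "x + z"] assms[of x "y + z"]
  by (simp add: bd3_basis_def pair_simps wedge2_finsupp pair_wedge2 distrib_left right_diff_distrib)

text \<open>\<open>B2_eq_span\<close> and \<open>span_iff_pair\<close> test \<open>w\<close> against
  all functionals that kill the generators; passing to alternating ones loses nothing because
  \<open>w\<close> is alternating.\<close>

lemma B2_iff_cocycle:
  assumes w: "w \<in> C2 T"
  shows "w \<in> B2 form T \<longleftrightarrow> (\<forall>a. cocycle T a \<longrightarrow> pair a w = 0)"
proof -
  let ?G = "{bd3_basis form x y z | x y z. x \<in> T \<and> y \<in> T \<and> z \<in> T}"
  have "w \<in> B2 form T \<longleftrightarrow> (\<forall>f. (\<forall>g\<in>?G. pair f g = 0) \<longrightarrow> pair f w = 0)"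
    unfolding B2_eq_span using bd3_basis_finsupp C2_finsupp[OF w] by (intro span_iff_pair) auto
  also have "\<dots> \<longleftrightarrow> (\<forall>a. cocycle T a \<longrightarrow> pair a w = 0)"
  proof (intro iffI allI impI)
    fix a assume *: "\<forall>f. (\<forall>g\<in>?G. pair f g = 0) \<longrightarrow> pair f w = 0" and a: "cocycle T a"
    have "pair a (bd3_basis form x y z) = 0" if "x \<in> T" "y \<in> T" "z \<in> T" for x y z
    proof -
      have "a (p, q) = - a (q, p)" for p q by (rule cocycle_alt[OF a])
      from pair_bd3_basis[of a x y z, OF this] show ?thesis using cocycleD[OF a that] by simp
    qed
    then show "pair a w = 0" using * by blast
  next
    fix f assume *: "\<forall>a. cocycle T a \<longrightarrow> pair a w = 0" and f: "\<forall>g\<in>?G. pair f g = 0"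
    \<comment> \<open>The antisymmetrization of \<open>f\<close>; by \<open>pair_transpose\<close>
      it pairs with \<open>w\<close> to twice the value of \<open>f\<close>.\<close>
    define a where "a p = f p + (- 1) * f (snd p, fst p)" for p
    have "cocycle T a"
      unfolding cocycle_def
    proof (intro conjI allI ballI)
      fix x y z assume T: "x \<in> T" "y \<in> T" "z \<in> T"
      have "pair f (bd3_basis form x y z) = 0" using f T by blast
      then show "of_int (form x y) * a (x + y, z) - of_int (form x z) * a (x + z, y)
          + of_int (form y z) * a (y + z, x) = 0"
        by (simp add: bd3_basis_def pair_simps wedge2_finsupp pair_wedge2 a_def)
    qed (simp add: a_def)
    then have "pair a w = 0" using * by blast
    then show "pair f w = 0"
      using pair_transpose[OF w, of f] unfolding a_def pair_add_left by simp
  qed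
  finally show ?thesis .
qed

end

section \<open>The derived subalgebra\<close>

definition coset :: "'h::ab_group_add \<Rightarrow> 'h \<Rightarrow> 'h set" where
  "coset z a = (\<lambda>x. a + x) ` zsub z"

lemma zsub_0: "0 \<in> zsub z"
  unfolding zsub_def by (auto intro!: exI[of _ 0])

lemma zsub_minus: "x \<in> zsub z \<Longrightarrow> - x \<in> zsub z"
  unfolding zsub_def by auto

lemma zsub_add:
  assumes "x \<in> zsub z" "y \<in> zsub z"
  shows "x + y \<in> zsub z"
proof -
  define m where "m n = (\<Sum>i<n. z)" for n :: nat
  have zsub: "v \<in> zsub z \<longleftrightarrow> (\<exists>n. v = m n \<or> v = - m n)" for v
    by (simp add: zsub_def m_def)
  have m_add: "m (n + k) = m n + m k" for n k
    by (induction k) (simp_all add: m_def add.assoc)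
  \<comment> \<open>Integer multiples are encoded as signed natural ones, so a sum of mixed signs
    depends on which multiple is larger.\<close>
  have m_diff: "m n - m k \<in> zsub z" for n k
  proof (cases "k \<le> n")
    case True
    then have "m n = m (n - k) + m k" using m_add[of "n - k" k] by simp
    then show ?thesis using zsub by auto
  next
    case False
    then have "m k = m (k - n) + m n" using m_add[of "k - n" n] by simp
    then have "m n - m k = - m (k - n)" by simp
    then show ?thesis using zsub by blast
  qed
  obtain n k where "x = m n \<or> x = - m n" "y = m k \<or> y = - m k"
    using assms zsub by blast
  moreover have "m n + m k \<in> zsub z" using m_add[of n k] zsub by metis
  moreover have "- m n + - m k \<in> zsub z" using zsub_minus[OF \<open>m n + m k \<in> zsub z\<close>] by simp
  moreover have "m n + - m k \<in> zsub z" "- m n + m k \<in> zsub z"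
    using m_diff[of n k] m_diff[of k n] by simp_all
  ultimately show ?thesis by auto
qed

lemma zsub_self: "z \<in> zsub z"
  unfolding zsub_def by (auto intro!: exI[of _ "Suc 0"])

lemma cosets_eq: "cosets z = range (coset z)"
  by (simp add: cosets_def coset_def)

lemma setplus_coset: "setplus (coset z a) (coset z b) = coset z (a + b)"
proof
  show "setplus (coset z a) (coset z b) \<subseteq> coset z (a + b)"
  proof
    fix v assume "v \<in> setplus (coset z a) (coset z b)"
    then obtain x y where "x \<in> zsub z" "y \<in> zsub z" "v = (a + b) + (x + y)"
      unfolding setplus_def coset_def by (auto simp: ac_simps)
    then show "v \<in> coset z (a + b)" unfolding coset_def using zsub_add by blast
  qed
  show "coset z (a + b) \<subseteq> setplus (coset z a) (coset z b)"
  proof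
    fix v assume "v \<in> coset z (a + b)"
    then obtain x where "x \<in> zsub z" "v = (a + x) + (b + 0)"
      unfolding coset_def by (auto simp: ac_simps)
    then show "v \<in> setplus (coset z a) (coset z b)"
      unfolding setplus_def coset_def using zsub_0 by blast
  qed
qed

text \<open>Source of \<open>g (z, coset z z) = 0\<close>, the counterpart of
  \<open>\<phi> z = 0\<close> for cocycles.\<close>

lemma coset_self: "coset z z = coset z 0"
proof -
  have "v \<in> (\<lambda>x. z + x) ` zsub z" if "v \<in> zsub z" for v
    by (rule image_eqI[of _ _ "- z + v"]) (use zsub_add[OF zsub_minus[OF zsub_self] that] in simp_all)
  then show ?thesis
    unfolding coset_def using zsub_add[OF zsub_self] by auto
qed

section \<open>Tensor relations and the central part of a chain\<close>

context alternating_form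
begin

text \<open>These are the functionals on the direct sum of the tensor products of Q with H/Zz: one
  additive map for each central \<open>z\<close>.\<close>

definition tens_functional :: "('h \<times> 'h set \<Rightarrow> rat) \<Rightarrow> bool" where
  "tens_functional g \<longleftrightarrow>
     (\<forall>z\<in>K. \<forall>a b. g (z, coset z (a + b)) = g (z, coset z a) + g (z, coset z b))"

lemma tens_functional_add:
  "tens_functional g \<Longrightarrow> z \<in> K \<Longrightarrow> g (z, coset z (a + b)) = g (z, coset z a) + g (z, coset z b)"
  by (simp add: tens_functional_def)

lemma tens_functional_0:
  assumes "tens_functional g" "z \<in> K"
  shows "g (z, coset z 0) = 0" "g (z, coset z z) = 0"
  using tens_functional_add[OF assms, of 0 0] by (simp_all add: coset_self)

lemma tens_functional_diff:
  assumes "tens_functional g" "z \<in> K"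
  shows "g (z, coset z (a - b)) = g (z, coset z a) - g (z, coset z b)"
  using tens_functional_add[OF assms, of "a - b" b] by simp

lemma tens_rel_iff:
  assumes v: "v \<in> finsupp_on UNIV"
  shows "v \<in> tens_rel form \<longleftrightarrow> (\<forall>g. tens_functional g \<longrightarrow> pair g v = 0)"
proof -
  let ?G = "{delta (z, setplus A C) - delta (z, A) - delta (z, C) | z A C.
      z \<in> K \<and> A \<in> cosets z \<and> C \<in> cosets z}"
  have "v \<in> tens_rel form \<longleftrightarrow> (\<forall>g. (\<forall>u\<in>?G. pair g u = 0) \<longrightarrow> pair g v = 0)"
    unfolding tens_rel_def qspan_eq_span
    by (intro span_iff_pair v) (auto intro!: finsupp_UNIV_intros)
  moreover have "(\<forall>u\<in>?G. pair g u = 0) \<longleftrightarrow> tens_functional g" for g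
  proof -
    have G: "u \<in> ?G \<longleftrightarrow> (\<exists>z\<in>K. \<exists>a b. u = delta (z, coset z (a + b)) - delta (z, coset z a) - delta (z, coset z b))"
      for u
      unfolding cosets_eq setplus_coset[symmetric] by blast
    have "(\<forall>u\<in>?G. pair g u = 0) \<longleftrightarrow>
        (\<forall>z\<in>K. \<forall>a b. pair g (delta (z, coset z (a + b)) - delta (z, coset z a) - delta (z, coset z b)) = 0)"
      unfolding Ball_def G by blast
    also have "\<dots> \<longleftrightarrow> tens_functional g"
      by (simp add: tens_functional_def pair_simps diff_diff_eq)
    finally show ?thesis .
  qed
  ultimately show ?thesis by simp
qed

text \<open>A 2-chain lists each \<open>[x] \<and> [y]\<close> at both \<open>(x, y)\<close> and \<open>(y, x)\<close>, so in central degree \<open>[x] \<and> [y]\<close>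
  is sent to twice the class of \<open>x\<close>.\<close>

definition central_part :: "('h \<times> 'h \<Rightarrow> rat) \<Rightarrow> 'h \<times> 'h set \<Rightarrow> rat" where
  "central_part w = lin (\<lambda>p. if fst p + snd p \<in> K
     then delta (fst p + snd p, coset (fst p + snd p) (fst p)) else 0) w"

lemma central_part_in_tens_space: "central_part w \<in> tens_space form"
  unfolding central_part_def tens_space_def
  by (rule lin_in_subspace[OF subspace_finsupp_on])
    (auto simp: delta_in_finsupp_on cosets_eq qfun.subspace_0[OF subspace_finsupp_on])

lemma tens_space_finsupp: "v \<in> tens_space form \<Longrightarrow> v \<in> finsupp_on UNIV"
  unfolding tens_space_def by (rule subsetD[OF finsupp_on_mono[OF subset_UNIV]])

lemma pair_central_part:
  "pair g (central_part w) = pair (\<lambda>p. if fst p + snd p \<in> K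
     then g (fst p + snd p, coset (fst p + snd p) (fst p)) else 0) w"
  unfolding central_part_def
  by (subst pair_lin) (auto intro!: pair_cong finsupp_UNIV_intros)

lemma Z2_C2: "w \<in> Z2 form T \<Longrightarrow> w \<in> C2 T"
  by (simp add: Z2_def)

text \<open>The central degrees of a cocycle factor through \<open>central_part\<close> and vanish
  on \<open>w\<close> by \<open>rel\<close>; the other degrees form a coboundary, which vanishes on
  the cycle \<open>w\<close>.\<close>

lemma boundary_if_central_part_in_tens_rel:
  assumes w: "w \<in> Z2 form S" and rel: "central_part w \<in> tens_rel form" and nz: "S \<noteq> {}"
  shows "w \<in> B2 form S"
  unfolding B2_iff_cocycle[OF Z2_C2[OF w]]
proof (intro allI impI)
  fix a assume a: "cocycle S a"
  obtain \<phi> where \<phi>: "\<And>z x y. z \<in> K \<Longrightarrow> \<phi> z (x + y) = \<phi> z x + \<phi> z y" "\<And>z. z \<in> K \<Longrightarrow> \<phi> z z = 0"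
    "\<And>z x. z \<in> K \<Longrightarrow> x \<in> S \<Longrightarrow> \<phi> z x = a (x, z - x)"
    using cocycle_central_degree[OF a _ nz] by metis
  obtain c where c: "\<And>s x. s \<in> S \<Longrightarrow> x \<in> S \<Longrightarrow> s - x \<in> S \<Longrightarrow> a (x, s - x) = c s * of_int (form x s)"
    using cocycle_noncentral_degree[OF a] by metis
  \<comment> \<open>\<open>\<phi> z\<close> kills \<open>zsub z\<close>, so any choice of
    representative gives the same value.\<close>
  define g :: "'h \<times> 'h set \<Rightarrow> rat" where "g = (\<lambda>(z, A). \<phi> z (SOME x. x \<in> A))"
  have g: "g (z, coset z x) = \<phi> z x" if z: "z \<in> K" for z x
  proof -
    have \<phi>_0: "\<phi> z 0 = 0" using \<phi>(1)[OF z, of 0 0] by simp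
    have \<phi>_minus: "\<phi> z (- y) = - \<phi> z y" for y using \<phi>(1)[OF z, of "- y" y] \<phi>_0 by simp
    have "\<phi> z (\<Sum>i<n. z) = 0" for n :: nat
      by (induction n) (simp_all add: \<phi>_0 \<phi> z)
    then have \<phi>_zsub: "\<phi> z y = 0" if "y \<in> zsub z" for y
      using that \<phi>_minus by (auto simp: zsub_def)
    have "(SOME y. y \<in> coset z x) \<in> coset z x"
      by (rule someI[of _ "x + 0"]) (use zsub_0 in \<open>unfold coset_def, blast\<close>)
    then obtain y where "y \<in> zsub z" "(SOME y. y \<in> coset z x) = x + y" unfolding coset_def by blast
    then show ?thesis by (simp add: g_def \<phi>(1)[OF z] \<phi>_zsub)
  qed
  have "tens_functional g" by (simp add: tens_functional_def g \<phi>(1))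
  then have "pair g (central_part w) = 0"
    using rel tens_rel_iff[OF tens_space_finsupp[OF central_part_in_tens_space]] by blast
  then have central: "pair (\<lambda>p. if fst p + snd p \<in> K
     then g (fst p + snd p, coset (fst p + snd p) (fst p)) else 0) w = 0" (is "pair ?f w = 0")
    unfolding pair_central_part .
  \<comment> \<open>The coboundary of this 1-cochain is -1/2 times the noncentral part of
    \<open>a\<close>, hence the weight -2 below.\<close>
  have "pair (\<lambda>s. if s \<in> K then 0 else c s) (bd2 form w) = 0" using w by (simp add: Z2_def)
  then have noncentral: "pair (\<lambda>(x, y). - of_int (form x y) * (if x + y \<in> K then 0 else c (x + y)) / 2) w = 0"
    (is "pair ?h w = 0") unfolding pair_bd2 .
  have "pair a w = pair (\<lambda>p. ?f p + (- 2) * ?h p) w"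
  proof (rule pair_cong)
    fix p assume "w p \<noteq> 0"
    moreover obtain x y where p: "p = (x, y)" by fastforce
    ultimately have S: "x \<in> S" "y \<in> S" using C2_supp[OF Z2_C2[OF w]] by blast+
    show "a p = ?f p + (- 2) * ?h p"
    proof (cases "x + y \<in> K")
      case True
      then show ?thesis using \<phi>(3)[OF True S(1)] by (simp add: p g)
    next
      case False
      then show ?thesis using c[of "x + y" x] S by (simp add: p form_simps)
    qed
  qed
  then show "pair a w = 0" unfolding pair_add_left using central noncentral by simp
qed

text \<open>A tensor functional pulled back along \<open>central_part\<close> is a cocycle, and
  cocycles vanish on boundaries.\<close>

lemma central_part_of_boundary:
  assumes w: "w \<in> Z2 form S" and bd: "w \<in> B2 form S"
  shows "central_part w \<in> tens_rel form"
  unfolding tens_rel_iff[OF tens_space_finsupp[OF central_part_in_tens_space]] pair_central_part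
proof (intro allI impI)
  fix g assume g: "tens_functional g"
  define a where "a p = (if fst p + snd p \<in> K
     then g (fst p + snd p, coset (fst p + snd p) (fst p)) else 0)" for p
  have "cocycle S a"
    unfolding cocycle_def
  proof (intro conjI allI ballI)
    fix x y
    show "a (x, y) = - a (y, x)"
    proof (cases "x + y \<in> K")
      case True
      then have "g (x + y, coset (x + y) x) + g (x + y, coset (x + y) y) = 0"
        using tens_functional_add[OF g True, of x y] tens_functional_0[OF g True] by simp
      then show ?thesis using True by (simp add: a_def add.commute)
    qed (simp add: a_def add.commute)
  next
    fix x y w
    show "of_int (form x y) * a (x + y, w) - of_int (form x w) * a (x + w, y)
        + of_int (form y w) * a (y + w, x) = 0"
    proof (cases "x + y + w \<in> K")
      case True
      \<comment> \<open>With central sum the three pairings agree up to sign, and the bracketed sum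
        \<open>\<phi> (x + y) + \<phi> (x + w) + \<phi> (y + w)\<close> is twice
        \<open>\<phi> z\<close>, which is zero.\<close>
      have "form x (x + y + w) = 0" "form y (x + y + w) = 0" using K_right[OF True] by blast+
      then have f: "form x w = - form x y" "form y w = form x y"
        using swap[of x y] by (simp_all add: form_simps)
      define z where "z = x + y + w"
      define \<phi> where "\<phi> v = g (z, coset z v)" for v
      have \<phi>: "\<phi> (u + v) = \<phi> u + \<phi> v" "\<phi> z = 0" for u v
        unfolding \<phi>_def using tens_functional_add[OF g] tens_functional_0[OF g] True
        by (simp_all add: z_def)
      have "a (x + y, w) = \<phi> (x + y)" "a (x + w, y) = \<phi> (x + w)" "a (y + w, x) = \<phi> (y + w)"
        using True by (simp_all add: a_def \<phi>_def z_def ac_simps)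
      moreover have "\<phi> w = - \<phi> x - \<phi> y" using \<phi>(2) \<phi>(1)[of "x + y" w] \<phi>(1)[of x y] by (simp add: z_def)
      ultimately show ?thesis
        by (simp add: f \<phi>(1) distrib_left right_diff_distrib)
    next
      case False
      then show ?thesis by (simp add: a_def ac_simps)
    qed
  qed
  then show "pair (\<lambda>p. if fst p + snd p \<in> K
     then g (fst p + snd p, coset (fst p + snd p) (fst p)) else 0) w = 0"
    using bd B2_iff_cocycle[OF Z2_C2[OF w]] unfolding a_def by blast
qed

lemma central_part_linear:
  assumes "u \<in> Z2 form T" "v \<in> Z2 form T"
  shows "central_part (c *s u + v) = c *s central_part u + central_part v"
  unfolding central_part_def by (rule lin_linear[OF assms[THEN Z2_C2, THEN C2_finsupp]])

lemma wedge2_in_Z2: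
  assumes "x \<in> T" "y \<in> T" "form x y = 0"
  shows "wedge2 x y \<in> Z2 form T"
  using assms wedge2_in_C2[OF assms(1,2)] swap[of x y]
  by (simp add: Z2_def bd2_lin lin_wedge2 gbracket_def fun_eq_iff)

lemma central_part_surjective:
  assumes v: "v \<in> tens_space form" and nz: "S \<noteq> {}"
  shows "\<exists>u\<in>Z2 form S. v - central_part u \<in> tens_rel form"
proof -
  let ?V = "{v. \<exists>u\<in>Z2 form S. v - central_part u \<in> tens_rel form}"
  note Z2 = qfun.subspace_0[OF subspace_Z2] qfun.subspace_add[OF subspace_Z2]
    qfun.subspace_scale[OF subspace_Z2]
  have rel: "qfun.subspace (tens_rel form)" by (simp add: tens_rel_def qspan_eq_span)
  have c0: "central_part 0 = 0" by (simp add: central_part_def lin_def fsupp_def)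
  have V: "qfun.subspace ?V"
  proof (rule qfun.subspaceI)
    show "0 \<in> ?V" using Z2(1) c0 qfun.subspace_0[OF rel] by force
  next
    fix v v' assume "v \<in> ?V" "v' \<in> ?V"
    then obtain u u' where u: "u \<in> Z2 form S" "u' \<in> Z2 form S"
      "v - central_part u \<in> tens_rel form" "v' - central_part u' \<in> tens_rel form" by blast
    have eq: "(v + v') - central_part (u + u') = (v - central_part u) + (v' - central_part u')"
      using central_part_linear[OF u(1,2), of 1] by simp
    show "v + v' \<in> ?V"
      using qfun.subspace_add[OF rel u(3,4)] Z2(2)[OF u(1,2)] unfolding eq[symmetric] by blast
  next
    fix c v assume "v \<in> ?V"
    then obtain u where u: "u \<in> Z2 form S" "v - central_part u \<in> tens_rel form" by blast
    have eq: "c *s v - central_part (c *s u) = c *s (v - central_part u)"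
      using central_part_linear[OF u(1) Z2(1), of c] c0 by (simp add: qfun.scale_right_diff_distrib)
    show "c *s v \<in> ?V"
      using qfun.subspace_scale[OF rel u(2), of c] Z2(3)[OF u(1), of c] unfolding eq[symmetric] by blast
  qed
  have basis: "delta (z, coset z a) \<in> ?V" if z: "z \<in> K" for z a
  proof -
    obtain s\<^sub>0 where "s\<^sub>0 \<in> S" using nz by blast
    \<comment> \<open>\<open>a\<close> itself may be central, so it is written as the difference of
      \<open>y + a\<close> and \<open>y\<close>, both outside the kernel.\<close>
    from ex_translate_in_S[OF this] obtain y where y: "y \<in> S" "y + a \<in> S" by blast
    have cp: "z - y \<in> S" "z - (y + a) \<in> S" using y z K_diff_S by blast+
    have w: "wedge2 x (z - x) \<in> Z2 form S" if "x \<in> S" "z - x \<in> S" for x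
      using that by (rule wedge2_in_Z2) (simp add: form_simps K_right[OF z])
    \<comment> \<open>Each \<open>wedge2 x (z - x)\<close> goes to twice the class of
      \<open>x\<close> modulo \<open>tens_rel\<close>, hence the halves.\<close>
    define u where "u = (1/2) *s wedge2 (y + a) (z - (y + a)) - (1/2) *s wedge2 y (z - y)"
    have u: "u \<in> Z2 form S"
      unfolding u_def using w y cp by (intro Z2(3) qfun.subspace_diff[OF subspace_Z2])
    have "delta (z, coset z a) - central_part u \<in> tens_rel form"
    proof -
      have fin: "central_part u \<in> finsupp_on UNIV"
        using central_part_in_tens_space tens_space_finsupp by blast
      have "pair g (delta (z, coset z a) - central_part u) = 0" if g: "tens_functional g" for g
      proof -
        have "pair g (central_part u) = g (z, coset z a)"
          unfolding pair_central_part u_def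
          by (simp add: pair_diff pair_scale finsupp_UNIV_intros wedge2_finsupp pair_wedge2 z
              tens_functional_add[OF g z] tens_functional_diff[OF g z] tens_functional_0[OF g z]
              add_divide_distrib diff_divide_distrib)
        then show ?thesis by (simp add: pair_diff fin finsupp_UNIV_intros)
      qed
      then show ?thesis
        using fin by (subst tens_rel_iff) (auto intro!: finsupp_UNIV_intros)
    qed
    then show ?thesis using u by blast
  qed
  have "v = (\<Sum>q\<in>fsupp v. v q *s delta q)"
    using v unfolding tens_space_def by (rule finsupp_on_decompose)
  moreover have "(\<Sum>q\<in>fsupp v. v q *s delta q) \<in> ?V"
  proof (rule qfun.subspace_sum[OF V])
    fix q assume "q \<in> fsupp v"
    then have "q \<in> {(z, A). z \<in> K \<and> A \<in> cosets z}"
      using v unfolding tens_space_def finsupp_on_def by blast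
    then have "delta q \<in> ?V" using basis unfolding cosets_eq by blast
    then show "v q *s delta q \<in> ?V" by (rule qfun.subspace_scale[OF V])
  qed
  ultimately show ?thesis by simp
qed

lemma H2_derived_iso:
  assumes nz: "S \<noteq> {}"
  shows "quot_iso (Z2 form S) (B2 form S) (tens_space form) (tens_rel form)"
  unfolding quot_iso_def linear_on_def
  using central_part_linear central_part_in_tens_space central_part_surjective[OF _ nz]
    central_part_of_boundary boundary_if_central_part_in_tens_rel[OF _ _ nz]
  by (intro exI[of _ central_part]) blast

section \<open>The full algebra\<close>

definition restr :: "'h set \<Rightarrow> ('h \<times> 'h \<Rightarrow> rat) \<Rightarrow> 'h \<times> 'h \<Rightarrow> rat" where
  "restr T w p = (if p \<in> T \<times> T then w p else 0)"

lemma restr_in_C2: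
  assumes "w \<in> C2 T"
  shows "restr U w \<in> C2 U"
proof -
  have "fsupp (restr U w) \<subseteq> fsupp w \<inter> (U \<times> U)" by (auto simp: restr_def fsupp_def)
  then have "restr U w \<in> finsupp_on (U \<times> U)"
    using C2_finsupp[OF assms] unfolding finsupp_on_def by (auto intro: finite_subset)
  moreover have "restr U w (x, y) = - restr U w (y, x)" for x y
    using C2_alt[OF assms, of x y] by (simp add: restr_def)
  ultimately show ?thesis unfolding C2_def by blast
qed

lemma pair_restr:
  assumes "w \<in> finsupp_on UNIV"
  shows "pair f (restr T w) = pair (\<lambda>p. if p \<in> T \<times> T then f p else 0) w"
proof -
  have "finite (fsupp w)" "fsupp (restr T w) \<subseteq> fsupp w"
    using assms by (auto simp: finsupp_on_def restr_def fsupp_def)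
  then have "pair f (restr T w) = (\<Sum>p\<in>fsupp w. restr T w p * f p)" by (rule pair_superset)
  also have "\<dots> = pair (\<lambda>p. if p \<in> T \<times> T then f p else 0) w"
    unfolding pair_def by (rule sum.cong) (auto simp: restr_def)
  finally show ?thesis .
qed

lemma bd2_restr_S:
  assumes "w \<in> finsupp_on UNIV"
  shows "bd2 form (restr S w) = bd2 form w"
  unfolding bd2_lin fun_eq_iff lin_apply pair_restr[OF assms]
  by (auto intro!: pair_cong simp: gbracket_def K_left K_right)

lemma bd2_C2_K:
  assumes w: "w \<in> C2 K"
  shows "bd2 form w = 0"
proof -
  have "gbracket form (fst p) (snd p) = 0" if "w p \<noteq> 0" for p
    using C2_supp[OF w, of "fst p" "snd p"] that by (simp add: gbracket_def K_left)
  then have "bd2 form w \<in> {0}"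
    unfolding bd2_lin by (intro lin_in_subspace qfun.subspace_single_0) simp
  then show ?thesis by simp
qed

text \<open>Forward, cocycles are constructed: \<open>wedge2 x y\<close> for central
  \<open>x\<close> and \<open>y\<close>, and the extension by zero of a cocycle on \<open>S\<close>.
  Backward, every cocycle on the whole group vanishes on mixed pairs, so only its values on
  \<open>S\<close> matter once \<open>w\<close> has no central pairs.\<close>

lemma B2_UNIV_iff:
  assumes w: "w \<in> C2 UNIV"
  shows "w \<in> B2 form UNIV \<longleftrightarrow> restr K w = 0 \<and> restr S w \<in> B2 form S"
proof
  note fin = C2_finsupp[OF w]
  assume bd: "w \<in> B2 form UNIV"
  have "w (x, y) = 0" if "x \<in> K" "y \<in> K" for x y
  proof -
    have "cocycle UNIV (wedge2 x y)"
      unfolding cocycle_def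
    proof (intro conjI allI ballI)
      show "wedge2 x y (p, q) = - wedge2 x y (q, p)" for p q
        by (simp add: wedge2_def delta_def conj_commute)
      \<comment> \<open>A nonzero pairing puts \<open>p + q\<close> outside the kernel, away from
        \<open>x\<close> and \<open>y\<close>: no bracket reaches a central symbol.\<close>
      have *: "of_int (form p q) * wedge2 x y (p + q, r) = 0" for p q r
      proof (cases "form p q = 0")
        case False
        then have "form (p + q) q \<noteq> 0" by (simp add: form_simps)
        then have "p + q \<in> S" by (rule in_S)
        then have "p + q \<noteq> x" "p + q \<noteq> y" using that by blast+
        then show ?thesis by (simp add: wedge2_def delta_def)
      qed simp
      show "of_int (form p q) * wedge2 x y (p + q, r) - of_int (form p r) * wedge2 x y (p + r, q)
          + of_int (form q r) * wedge2 x y (q + r, p) = 0" for p q r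
        by (simp add: *)
    qed
    then have "pair (wedge2 x y) w = 0" using bd B2_iff_cocycle[OF w] by blast
    \<comment> \<open>\<open>wedge2 x y\<close> serves as functional and as chain; exchanging the
      roles evaluates the pairing as \<open>w (x, y) - w (y, x)\<close>.\<close>
    moreover have "pair (wedge2 x y) w = pair w (wedge2 x y)"
    proof -
      have "pair (wedge2 x y) w = (\<Sum>p\<in>fsupp w \<union> fsupp (wedge2 x y). w p * wedge2 x y p)"
        using fin wedge2_finsupp[of x y] by (intro pair_superset) (auto simp: finsupp_on_def)
      also have "\<dots> = (\<Sum>p\<in>fsupp w \<union> fsupp (wedge2 x y). wedge2 x y p * w p)"
        by (simp only: mult.commute)
      also have "\<dots> = pair w (wedge2 x y)"
        using fin wedge2_finsupp[of x y] by (intro pair_superset[symmetric]) (auto simp: finsupp_on_def)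
      finally show ?thesis .
    qed
    ultimately show ?thesis using C2_alt[OF w, of x y] by (simp add: pair_wedge2)
  qed
  then have "restr K w = 0" by (auto simp: restr_def fun_eq_iff)
  moreover have "restr S w \<in> B2 form S"
    unfolding B2_iff_cocycle[OF restr_in_C2[OF w]] pair_restr[OF fin]
  proof (intro allI impI)
    fix a assume a: "cocycle S a"
    define b where "b p = (if p \<in> S \<times> S then a p else 0)" for p
    have "cocycle UNIV b"
      unfolding cocycle_def
    proof (intro conjI allI ballI)
      show "b (p, q) = - b (q, p)" for p q
        using cocycle_alt[OF a, of q p] by (simp add: b_def)
      fix p q r
      \<comment> \<open>A nonzero coefficient puts \<open>x + y\<close> in \<open>S\<close>
        automatically, so only a central \<open>v\<close> changes the term.\<close>
      have *: "of_int (form x y) * b (x + y, v) = (if v \<in> S then of_int (form x y) * a (x + y, v) else 0)"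
        for x y v
      proof (cases "form x y = 0")
        case False
        then have "form (x + y) y \<noteq> 0" by (simp add: form_simps)
        then have "x + y \<in> S" by (rule in_S)
        then show ?thesis by (simp add: b_def)
      qed simp
      show "of_int (form p q) * b (p + q, r) - of_int (form p r) * b (p + r, q)
          + of_int (form q r) * b (q + r, p) = 0"
        unfolding * using cocycleD[OF a, of p q r]
        by (auto simp: K_left K_right)
    qed
    then show "pair (\<lambda>p. if p \<in> S \<times> S then a p else 0) w = 0"
      using bd B2_iff_cocycle[OF w] unfolding b_def by blast
  qed
  ultimately show "restr K w = 0 \<and> restr S w \<in> B2 form S" by blast
next
  note fin = C2_finsupp[OF w]
  assume *: "restr K w = 0 \<and> restr S w \<in> B2 form S"
  show "w \<in> B2 form UNIV"
    unfolding B2_iff_cocycle[OF w]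
  proof (intro allI impI)
    fix a assume a: "cocycle UNIV a"
    then have "cocycle S a" unfolding cocycle_def by blast
    then have "pair a (restr S w) = 0" using * B2_iff_cocycle[OF restr_in_C2[OF w]] by blast
    moreover have "a (s, k) = 0" if "s \<in> S" "k \<in> K" for s k
    proof -
      \<comment> \<open>[s] is a multiple of the bracket of [u] and [s - u], whose pairing is
        \<open>form u s\<close>; the other two terms of the identity contain a pairing with
        \<open>k\<close>.\<close>
      obtain u where "form u s \<noteq> 0" using S_partner[OF \<open>s \<in> S\<close>] by blast
      then show ?thesis
        using cocycleD[OF a, of u "s - u" k] K_right[OF \<open>k \<in> K\<close>] by (simp add: form_simps)
    qed
    then have mixed: "a (s, k) = 0" "a (k, s) = 0" if "s \<in> S" "k \<in> K" for s k
      using that cocycle_alt[OF a, of k s] by simp_all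
    have "w p \<noteq> 0 \<Longrightarrow> a p = (if p \<in> S \<times> S then a p else 0)" for p
    proof -
      assume "w p \<noteq> 0"
      moreover have "restr K w p = 0" using * by simp
      ultimately have "p \<notin> K \<times> K" by (auto simp: restr_def)
      then show ?thesis using mixed by (cases p) auto
    qed
    then have "pair a w = pair a (restr S w)" unfolding pair_restr[OF fin] by (rule pair_cong)
    ultimately show "pair a w = 0" by simp
  qed
qed

text \<open>The map restricts a cycle to central pairs and to pairs from \<open>S\<close>. All
  chains on the kernel are cycles and only zero is a boundary among them, so the first summand is
  the full exterior square.\<close>

lemma H2_full_iso:
  "quot_iso (Z2 form UNIV) (B2 form UNIV) (dsum (C2 K) (Z2 form S)) (dsum {0} (B2 form S))"
proof -
  define G where "G w q = (case q of Inl p \<Rightarrow> restr K w p | Inr p \<Rightarrow> restr S w p)"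
    for w :: "'h \<times> 'h \<Rightarrow> rat" and q
  have G: "(\<lambda>p. G w (Inl p)) = restr K w" "(\<lambda>p. G w (Inr p)) = restr S w" for w
    by (simp_all add: G_def)
  have "linear_on (Z2 form UNIV) G"
    by (auto simp: linear_on_def fun_eq_iff G_def restr_def split: sum.split)
  moreover have "G ` Z2 form UNIV \<subseteq> dsum (C2 K) (Z2 form S)"
    by (auto simp: dsum_def G Z2_def restr_in_C2 bd2_restr_S[OF C2_finsupp])
  moreover have "\<exists>u\<in>Z2 form UNIV. v - G u \<in> dsum {0} (B2 form S)"
    if v: "v \<in> dsum (C2 K) (Z2 form S)" for v
  proof -
    define k s where "k = (\<lambda>p. v (Inl p))" and "s = (\<lambda>p. v (Inr p))"
    have k: "k \<in> C2 K" and s: "s \<in> C2 S" "bd2 form s = 0"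
      using v by (simp_all add: dsum_def k_def s_def Z2_def)
    have C2_UNIV: "u \<in> C2 UNIV" if "u \<in> C2 T" for u :: "'h \<times> 'h \<Rightarrow> rat" and T
      using that C2_finsupp[OF that] unfolding C2_def UNIV_Times_UNIV by blast
    have "k + s \<in> Z2 form UNIV"
      using qfun.subspace_add[OF subspace_C2 C2_UNIV[OF k] C2_UNIV[OF s(1)]]
        bd2_linear[OF C2_finsupp[OF k] C2_finsupp[OF s(1)], of form 1] bd2_C2_K[OF k] s(2)
      by (simp add: Z2_def)
    moreover have "v = G (k + s)"
    proof
      fix q
      have kp: "k p = 0" if "p \<notin> K \<times> K" for p using that C2_supp[OF k] by (cases p) blast
      have sp: "s p = 0" if "p \<notin> S \<times> S" for p using that C2_supp[OF s(1)] by (cases p) blast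
      show "v q = G (k + s) q"
      proof (cases q)
        case (Inl p)
        then show ?thesis using kp[of p] sp[of p] by (auto simp: G_def restr_def k_def)
      next
        case (Inr p)
        then show ?thesis using kp[of p] sp[of p] by (auto simp: G_def restr_def s_def)
      qed
    qed
    ultimately show ?thesis
      using qfun.subspace_0[OF subspace_B2, of form S]
      by (intro bexI[of _ "k + s"]) (simp_all add: dsum_def zero_fun_def)
  qed
  moreover have "G u \<in> dsum {0} (B2 form S) \<longleftrightarrow> u \<in> B2 form UNIV" if "u \<in> Z2 form UNIV" for u
    using B2_UNIV_iff[OF Z2_C2[OF that]] by (simp add: dsum_def G)
  ultimately show ?thesis unfolding quot_iso_def by blast
qed

end

theorem theorem1p1:
  fixes form :: "'h::ab_group_add \<Rightarrow> 'h \<Rightarrow> int"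
  assumes "\<forall>x y z. form (x + y) z = form x z + form y z"
    and "\<forall>x y z. form x (y + z) = form x y + form x z"
    and "\<forall>x. form x x = 0"
    and "\<exists>x y. form x y \<noteq> 0"
  shows "quot_iso (Z2 form (UNIV - kerf form)) (B2 form (UNIV - kerf form))
                  (tens_space form) (tens_rel form)
       \<and> quot_iso (Z2 form UNIV) (B2 form UNIV)
                  (dsum (C2 (kerf form)) (Z2 form (UNIV - kerf form)))
                  (dsum {0} (B2 form (UNIV - kerf form)))"
proof -
  interpret alternating_form form
    by unfold_locales (use assms in blast)+
  have "UNIV - kerf form \<noteq> {}" using assms(4) in_S(1) by blast
  then show ?thesis using H2_derived_iso H2_full_iso by blast
qed

end
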